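(* Let $1 \leq p < \infty$ and let $T \colon E \longrightarrow F$ be a non-$p$-convergent operator between Banach spaces. Then the set of weakly $p$-summable sequences $(x_j)_{j=1}^\infty$ in $E$ such that $(T(x_j))_{j=1}^\infty$ is non-norm null in $F$ is almost pointwise spaceable in $c_0^w(E)$.
   Context: Banach spaces are real or complex; operators are bounded and linear. A sequence $(x_j)_{j=1}^\infty$ in a Banach space $E$ is weakly $p$-summable if $(x^*(x_j))_{j=1}^\infty \in \ell_p$ for every $x^* \in E^*$. A bounded linear operator between Banach spaces is $p$-convergent if it sends weakly $p$-summable sequences to norm null sequences. $c_0^w(E)$ is the Banach space of weakly null $E$-valued sequences with the supremum norm. A Banach sequence space is a linear subspace of $E^{\mathbb{N}}$ endowed with a complete norm. A nonempty subset $B$ of a Banach sequence space $X$ is almost pointwise spaceable (in $X$) if for every sequence $\mathbf{x} \in B$ there exists a closed infinite dimensional subspace of $X$ contained in $B \cup \{0\}$ and containing a subsequence of $\mathbf{x}$. *)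

theory Defs
  imports "HOL-Analysis.Analysis" "HOL-Library.Function_Algebras"
begin

(* The scalar field is the field of real or the field of complex numbers: every instance of this
   class is a copy of one of the two, and both are instances. *)
class real_or_complex = real_normed_field +
  assumes real_or_complex:
    "(\<forall>z. \<exists>a. z = a *\<^sub>R 1) \<or>
     (\<exists>\<iota>. \<iota> * \<iota> = - 1 \<and> (\<forall>z. \<exists>a b. z = a *\<^sub>R 1 + b *\<^sub>R \<iota>))"

instance real :: real_or_complex
  by standard simp

instance complex :: real_or_complex
proof
  have "\<i> * \<i> = - 1 \<and> (\<forall>z. \<exists>a b. z = a *\<^sub>R 1 + b *\<^sub>R \<i>)"
    by (auto simp: complex_eq_iff)
  then show "(\<forall>z::complex. \<exists>a. z = a *\<^sub>R 1) \<or>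
     (\<exists>j::complex. j * j = - 1 \<and> (\<forall>z. \<exists>a b. z = a *\<^sub>R 1 + b *\<^sub>R j))"
    by blast
qed

(* A Banach space over 'k: the class banach supplies the complete norm and the underlying real
   structure, with which the scalar multiplication has to agree. *)
locale banach_space = vector_space scale
  for scale :: "'k::real_or_complex \<Rightarrow> 'e::banach \<Rightarrow> 'e" +
  assumes scale_of_real: "scale (of_real r) x = r *\<^sub>R x"
    and norm_scale: "norm (scale c x) = norm c * norm x"

definition bounded_operator ::
  "('k::real_or_complex \<Rightarrow> 'e::banach \<Rightarrow> 'e) \<Rightarrow> ('k \<Rightarrow> 'f::real_normed_vector \<Rightarrow> 'f) \<Rightarrow> ('e \<Rightarrow> 'f) \<Rightarrow> bool"
  where "bounded_operator sE sF T \<longleftrightarrow> Vector_Spaces.linear sE sF T \<and> bounded_linear T"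

definition dual :: "('k::real_or_complex \<Rightarrow> 'e::banach \<Rightarrow> 'e) \<Rightarrow> ('e \<Rightarrow> 'k) set"
  where "dual sE = {f. bounded_operator sE (*) f}"

definition ell :: "real \<Rightarrow> (nat \<Rightarrow> 'k::real_normed_vector) set"
  where "ell p = {a. summable (\<lambda>j. norm (a j) powr p)}"

definition weakly_p_summable ::
  "('k::real_or_complex \<Rightarrow> 'e::banach \<Rightarrow> 'e) \<Rightarrow> real \<Rightarrow> (nat \<Rightarrow> 'e) \<Rightarrow> bool"
  where "weakly_p_summable sE p x \<longleftrightarrow> (\<forall>f \<in> dual sE. (\<lambda>j. f (x j)) \<in> ell p)"

definition p_convergent ::
  "('k::real_or_complex \<Rightarrow> 'e::banach \<Rightarrow> 'e) \<Rightarrow> real \<Rightarrow> ('e \<Rightarrow> 'f::banach) \<Rightarrow> bool"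
  where "p_convergent sE p T \<longleftrightarrow>
    (\<forall>x. weakly_p_summable sE p x \<longrightarrow> (\<lambda>j. T (x j)) \<longlonglongrightarrow> 0)"

definition c0w :: "('k::real_or_complex \<Rightarrow> 'e::banach \<Rightarrow> 'e) \<Rightarrow> (nat \<Rightarrow> 'e) set"
  where "c0w sE = {x. \<forall>f \<in> dual sE. (\<lambda>j. f (x j)) \<longlonglongrightarrow> 0}"

(* Only used on c0w, whose members are norm bounded by the uniform boundedness principle. *)
definition sup_norm :: "(nat \<Rightarrow> 'e::banach) \<Rightarrow> real"
  where "sup_norm x = (SUP j. norm (x j))"

definition seq_scale :: "('k \<Rightarrow> 'e \<Rightarrow> 'e) \<Rightarrow> 'k \<Rightarrow> (nat \<Rightarrow> 'e) \<Rightarrow> (nat \<Rightarrow> 'e)"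
  where "seq_scale sE c x = (\<lambda>j. sE c (x j))"

lemma vector_space_seq_scale:
  assumes "vector_space sE"
  shows "vector_space (seq_scale sE)"
proof -
  interpret vector_space sE by fact
  show ?thesis
    by standard
      (auto simp: seq_scale_def fun_eq_iff scale_right_distrib scale_left_distrib)
qed

(* The library's locale of metric spaces asks for nonnegativity and symmetry also outside the
   carrier, where N is arbitrary. *)
definition norm_dist :: "'a::ab_group_add set \<Rightarrow> ('a \<Rightarrow> real) \<Rightarrow> 'a \<Rightarrow> 'a \<Rightarrow> real"
  where "norm_dist X N x y = (if x \<in> X \<and> y \<in> X then N (x - y) else 0)"

locale banach_sequence_space = banach_space sE
  for sE :: "'k::real_or_complex \<Rightarrow> 'e::banach \<Rightarrow> 'e" +
  fixes X :: "(nat \<Rightarrow> 'e) set" and N :: "(nat \<Rightarrow> 'e) \<Rightarrow> real"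
  assumes subspace: "module.subspace (seq_scale sE) X"
    and nonneg: "x \<in> X \<Longrightarrow> 0 \<le> N x"
    and eq_0_iff: "x \<in> X \<Longrightarrow> N x = 0 \<longleftrightarrow> x = 0"
    and homogeneous: "x \<in> X \<Longrightarrow> N (seq_scale sE c x) = norm c * N x"
    and triangle: "x \<in> X \<Longrightarrow> y \<in> X \<Longrightarrow> N (x + y) \<le> N x + N y"
    and complete: "Metric_space.mcomplete X (norm_dist X N)"

lemma (in banach_sequence_space) Metric_space_norm_dist: "Metric_space X (norm_dist X N)"
proof -
  interpret seq: vector_space "seq_scale sE"
    by (rule vector_space_seq_scale) (rule vector_space_axioms)
  have diff: "x - y \<in> X" if "x \<in> X" "y \<in> X" for x y
    using seq.subspace_diff[OF subspace that] .
  have "N (y - x) = N (x - y)" if "x \<in> X" "y \<in> X" for x y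
    using homogeneous[OF diff[OF that], of "- 1"] by simp
  moreover have "N (x - z) \<le> N (x - y) + N (y - z)" if "x \<in> X" "y \<in> X" "z \<in> X" for x y z
    using triangle[OF diff[OF that(1,2)] diff[OF that(2,3)]] by simp
  ultimately show ?thesis
    by unfold_locales (auto simp: norm_dist_def nonneg eq_0_iff diff)
qed

definition closed_infinite_dimensional_subspace ::
  "('k::real_or_complex \<Rightarrow> 'e::banach \<Rightarrow> 'e) \<Rightarrow> (nat \<Rightarrow> 'e) set \<Rightarrow> ((nat \<Rightarrow> 'e) \<Rightarrow> real) \<Rightarrow>
    (nat \<Rightarrow> 'e) set \<Rightarrow> bool"
  where "closed_infinite_dimensional_subspace sE X N W \<longleftrightarrow>
    W \<subseteq> X \<and> module.subspace (seq_scale sE) W \<and>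
    closedin (Metric_space.mtopology X (norm_dist X N)) W \<and>
    (\<nexists>S. finite S \<and> W = module.span (seq_scale sE) S)"

definition almost_pointwise_spaceable ::
  "('k::real_or_complex \<Rightarrow> 'e::banach \<Rightarrow> 'e) \<Rightarrow> (nat \<Rightarrow> 'e) set \<Rightarrow> ((nat \<Rightarrow> 'e) \<Rightarrow> real) \<Rightarrow>
    (nat \<Rightarrow> 'e) set \<Rightarrow> bool"
  where "almost_pointwise_spaceable sE X N B \<longleftrightarrow>
    banach_sequence_space sE X N \<and> B \<noteq> {} \<and> B \<subseteq> X \<and>
    (\<forall>x \<in> B. \<exists>W. closed_infinite_dimensional_subspace sE X N W \<and> W \<subseteq> B \<union> {0} \<and>
       (\<exists>r. strict_mono r \<and> x \<circ> r \<in> W))"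

end

theory Submission
  imports Defs
begin

text \<open>
  The idea is to multiply instead of superposing. Let \<open>x\<close> be weakly \<open>p\<close>-summable with
  \<open>T (x j)\<close> not null, and let \<open>y\<close> be a subsequence along which \<open>norm (T (y j))\<close> stays above some
  \<open>\<delta> > 0\<close>. Multiplying \<open>y\<close> termwise by a bounded scalar sequence preserves weak
  \<open>p\<close>-summability, and \<open>norm (y j)\<close> is bounded away from 0 because \<open>T\<close> is bounded. Split the
  indices into infinitely many infinite sets, the fibres, and let \<open>W\<close> consist of the products
  \<open>b \<cdot> y\<close> with \<open>b\<close> bounded and constant on every fibre. Then \<open>b = 1\<close> gives \<open>y \<in> W\<close>; the indicators
  of the fibres make \<open>W\<close> infinite dimensional; and if \<open>b \<cdot> y \<noteq> 0\<close>, some nonzero value \<open>c\<close> of \<open>b\<close> is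
  taken infinitely often, so \<open>norm (T (b j \<cdot> y j)) \<ge> norm c * \<delta>\<close> infinitely often and the image
  is not null.

  To see that \<open>W\<close> is closed, choose functionals \<open>f j\<close> with \<open>f j (y j) = 1\<close>. A weakly null \<open>w\<close> lies in
  \<open>W\<close> exactly if \<open>w i = f j (w j) \<cdot> y i\<close> whenever \<open>i\<close> and \<open>j\<close> are in the same fibre, and these
  equations survive pointwise limits. The coefficients \<open>f j (w j)\<close> are bounded because \<open>w\<close> is
  norm bounded and \<open>y\<close> is bounded away from 0.

  The functionals \<open>f j\<close> and the norm boundedness of weakly null sequences, which also makes the
  supremum a norm on \<open>c0w\<close>, rest on the Hahn-Banach theorem
  (\<open>Hahn_Banach_sublinear\<close>) and on the uniform boundedness principle
  (\<open>weakly_bounded_imp_norm_bounded\<close>). Both are proved for real functionals;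
  \<open>real_functional_dominated_by_dual\<close> carries their consequences over to the scalar field.
\<close>

section \<open>Norming functionals and uniform boundedness\<close>

definition sublinear :: "('a::real_vector \<Rightarrow> real) \<Rightarrow> bool"
  where "sublinear q \<longleftrightarrow>
    (\<forall>x y. q (x + y) \<le> q x + q y) \<and> (\<forall>t x. 0 \<le> t \<longrightarrow> q (t *\<^sub>R x) = t * q x)"

lemma sublinear_add: "sublinear q \<Longrightarrow> q (x + y) \<le> q x + q y"
  and sublinear_scale: "sublinear q \<Longrightarrow> 0 \<le> t \<Longrightarrow> q (t *\<^sub>R x) = t * q x"
  by (simp_all add: sublinear_def)

lemma sublinear_zero: "sublinear q \<Longrightarrow> q 0 = 0"
  using sublinear_scale[of q 0 0] by simp

lemma sublinear_minus_lower: 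
  assumes "sublinear q"
  shows "- q (- x) \<le> q x"
  using sublinear_add[OF assms, of x "- x"] sublinear_zero[OF assms] by simp

text \<open>
  One-sided homogeneity is enough: applied to \<open>c\<close> and to its inverse it gives equality, and applied
  to the vector 0 with \<open>c = 2\<close> and \<open>c = 1/2\<close> it forces the value 0 there.
\<close>

lemma sublinearI:
  assumes add: "\<And>x y. q (x + y) \<le> q x + q y"
    and scale: "\<And>c x. 0 < c \<Longrightarrow> q (c *\<^sub>R x) \<le> c * q x"
  shows "sublinear q"
proof -
  have "q 0 = 0"
    using scale[of 2 0] scale[of "1/2" 0] by simp
  moreover have "q (c *\<^sub>R x) = c * q x" if "0 < c" for c x
    using scale[OF that, of x] scale[of "inverse c" "c *\<^sub>R x"] that by (simp add: field_simps)
  ultimately have "q (t *\<^sub>R x) = t * q x" if "0 \<le> t" for t x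
    using that by (cases "t = 0") auto
  with add show ?thesis
    by (simp add: sublinear_def)
qed

text \<open>
  Subadditivity survives an infimum if the two indices that are nearly optimal for \<open>y\<close> and for \<open>z\<close>
  can be merged into one that serves \<open>y + z\<close>. This is the common core of the two infima below: over
  the parameter of a half-line, where the parameters are added, and over a chain, where the smaller
  functional is taken.
\<close>

lemma sublinear_INF:
  fixes g :: "'i \<Rightarrow> 'a::real_vector \<Rightarrow> real"
  assumes ne: "I \<noteq> {}"
    and bdd: "\<And>y. bdd_below ((\<lambda>i. g i y) ` I)"
    and add: "\<And>i j y z. i \<in> I \<Longrightarrow> j \<in> I \<Longrightarrow> \<exists>k\<in>I. g k (y + z) \<le> g i y + g j z"
    and scale: "\<And>i c y. i \<in> I \<Longrightarrow> 0 < c \<Longrightarrow> \<exists>k\<in>I. g k (c *\<^sub>R y) \<le> c * g i y"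
  shows "sublinear (\<lambda>y. INF i\<in>I. g i y)"
proof (rule sublinearI)
  let ?u = "\<lambda>y. INF i\<in>I. g i y"
  have le: "?u y \<le> g i y" if "i \<in> I" for i y
    using cINF_lower[OF bdd that] .
  show "?u (y + z) \<le> ?u y + ?u z" for y z
  proof -
    have pair: "?u (y + z) - g i y \<le> g j z" if "i \<in> I" "j \<in> I" for i j
      using add[OF that, of y z] le[of _ "y + z"] by fastforce
    have "?u (y + z) - ?u z \<le> g i y" if "i \<in> I" for i
      using cINF_greatest[OF ne, of "?u (y + z) - g i y" "\<lambda>j. g j z"] pair[OF that] by fastforce
    then have "?u (y + z) - ?u z \<le> ?u y"
      using cINF_greatest[OF ne, of "?u (y + z) - ?u z" "\<lambda>i. g i y"] by blast
    then show ?thesis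
      by simp
  qed
  show "?u (c *\<^sub>R y) \<le> c * ?u y" if "0 < c" for c y
  proof -
    have "?u (c *\<^sub>R y) \<le> c * g i y" if "i \<in> I" for i
      using scale[OF that \<open>0 < c\<close>] le order_trans by meson
    then have "?u (c *\<^sub>R y) / c \<le> ?u y"
      using that by (intro cINF_greatest[OF ne]) (simp add: field_simps)
    with that show ?thesis
      by (simp add: field_simps)
  qed
qed

text \<open>
  The infimum of \<open>q (y + t x) - t q x\<close> over \<open>t \<ge> 0\<close> is the largest such \<open>r\<close>. Unless \<open>q\<close> is odd at \<open>x\<close>, it
  is strictly smaller than \<open>q\<close> at \<open>- x\<close>; this is how a minimal sublinear functional is seen to be odd.
\<close>

lemma sublinear_descent:
  fixes q :: "'a::real_vector \<Rightarrow> real"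
  assumes q: "sublinear q"
  obtains r where "sublinear r" "\<And>y. r y \<le> q y" "r (- x) \<le> - q x"
proof
  define g where "g t y = q (y + t *\<^sub>R x) - t * q x" for t y
  define r where "r y = (INF t\<in>{0..}. g t y)" for y
  have "- q (- y) \<le> g t y" if "0 \<le> t" for t y
    using sublinear_add[OF q, of "- y" "y + t *\<^sub>R x"] sublinear_scale[OF q that, of x]
    by (simp add: g_def)
  then have bdd: "bdd_below ((\<lambda>t. g t y) ` {0..})" for y
    by (intro bdd_belowI2[of _ "- q (- y)"]) auto
  show "sublinear r"
    unfolding r_def
  proof (rule sublinear_INF[OF _ bdd])
    fix s t :: real and y z
    assume "s \<in> {0..}" "t \<in> {0..}"
    moreover have "g (s + t) (y + z) \<le> g s y + g t z"
      using sublinear_add[OF q, of "y + s *\<^sub>R x" "z + t *\<^sub>R x"] by (simp add: g_def algebra_simps)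
    ultimately show "\<exists>k\<in>{0..}. g k (y + z) \<le> g s y + g t z"
      by (intro bexI[of _ "s + t"]) auto
  next
    fix t c :: real and y
    assume t: "t \<in> {0..}" "0 < c"
    have "g (c * t) (c *\<^sub>R y) = c * g t y"
      using sublinear_scale[OF q, of c "y + t *\<^sub>R x"] t by (simp add: g_def algebra_simps)
    then show "\<exists>k\<in>{0..}. g k (c *\<^sub>R y) \<le> c * g t y"
      using t by (intro bexI[of _ "c * t"]) auto
  qed auto
  have le: "r y \<le> g t y" if "0 \<le> t" for t y
    unfolding r_def using that by (intro cINF_lower[OF bdd]) auto
  show "r y \<le> q y" for y
    using le[of 0] by (simp add: g_def)
  show "r (- x) \<le> - q x"
    using le[of 1 "- x"] sublinear_zero[OF q] by (simp add: g_def)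
qed

text \<open>
  A minimal sublinear functional \<open>m\<close> equals each of its descents, so \<open>m (- z) \<le> - m z\<close> for every \<open>z\<close>:
  it is odd, and an odd sublinear functional is linear. Starting Zorn's lemma not from \<open>p\<close> but from
  its descent along \<open>x\<close> forces \<open>f (- x) \<le> - p x\<close>, which is the half of \<open>f x = p x\<close> that domination by
  \<open>p\<close> does not give. Chains have lower bounds because everything sublinear below \<open>q0\<close> is at least
  \<open>- q0 (- y)\<close> at \<open>y\<close>.
\<close>

lemma Hahn_Banach_sublinear:
  fixes p :: "'a::real_vector \<Rightarrow> real"
  assumes p: "sublinear p"
  obtains f where "linear f" "\<And>y. f y \<le> p y" "f x = p x"
proof -
  obtain q0 where q0: "sublinear q0" "\<And>y. q0 y \<le> p y" "q0 (- x) \<le> - p x"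
    using sublinear_descent[OF p] by blast
  define A where "A = {q. sublinear q \<and> (\<forall>y. q y \<le> q0 y)}"
  \<comment> \<open>Zorn's lemma yields maximal elements, hence the reversed order.\<close>
  define below :: "('a \<Rightarrow> real) \<Rightarrow> ('a \<Rightarrow> real) \<Rightarrow> bool" where "below q r \<longleftrightarrow> (\<forall>y. r y \<le> q y)" for q r
  have "\<exists>m\<in>A. \<forall>q\<in>A. below m q \<longrightarrow> q = m"
  proof (rule predicate_Zorn)
    show "partial_order_on A (relation_of below A)"
      by (rule partial_order_on_relation_ofI)
        (auto simp: below_def fun_eq_iff intro: order_trans order_antisym)
    fix C assume C: "C \<in> Chains (relation_of below A)"
    have CA: "C \<subseteq> A"
      and tot: "\<And>q r. q \<in> C \<Longrightarrow> r \<in> C \<Longrightarrow> below q r \<or> below r q"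
      using C by (auto simp: Chains_def relation_of_def)
    show "\<exists>u\<in>A. \<forall>q\<in>C. below q u"
    proof (cases "C = {}")
      case True
      with q0(1) show ?thesis
        by (auto simp: A_def)
    next
      case False
      have "- q0 (- y) \<le> q y" if "q \<in> C" for q y
      proof -
        have "sublinear q" "q (- y) \<le> q0 (- y)"
          using CA that by (auto simp: A_def)
        then show ?thesis
          using sublinear_minus_lower[of q y] by linarith
      qed
      then have bdd: "bdd_below ((\<lambda>q. q y) ` C)" for y
        by (intro bdd_belowI2[of _ "- q0 (- y)"])
      define u where "u y = (INF q\<in>C. q y)" for y
      have le: "u y \<le> q y" if "q \<in> C" for q y
        unfolding u_def using cINF_lower[OF bdd that] .
      have "sublinear u"
        unfolding u_def
      proof (rule sublinear_INF[OF False bdd])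
        fix q r y z
        assume qr: "q \<in> C" "r \<in> C"
        have sub: "sublinear q" "sublinear r"
          using qr CA by (auto simp: A_def)
        show "\<exists>k\<in>C. k (y + z) \<le> q y + r z"
          using tot[OF qr]
        proof
          assume "below q r"
          then have "r (y + z) \<le> q y + r z"
            using sublinear_add[OF sub(2), of y z] by (auto simp: below_def intro: order_trans)
          with qr show ?thesis by blast
        next
          assume "below r q"
          then have "q (y + z) \<le> q y + r z"
            using sublinear_add[OF sub(1), of y z] by (auto simp: below_def intro: order_trans)
          with qr show ?thesis by blast
        qed
      next
        fix q and c :: real and y
        assume "q \<in> C" "0 < c"
        then show "\<exists>k\<in>C. k (c *\<^sub>R y) \<le> c * q y"
          using CA sublinear_scale[of q c y] by (intro bexI[of _ q]) (auto simp: A_def)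
      qed
      moreover have "u y \<le> q0 y" for y
      proof -
        obtain q where "q \<in> C" using False by blast
        then show ?thesis
          using le[of q y] CA by (auto simp: A_def intro: order_trans)
      qed
      ultimately show ?thesis
        using le by (auto simp: A_def below_def)
    qed
  qed
  then obtain m where m: "sublinear m" "\<And>y. m y \<le> q0 y"
    and min: "\<And>q. sublinear q \<Longrightarrow> (\<And>y. q y \<le> q0 y) \<Longrightarrow> (\<And>y. q y \<le> m y) \<Longrightarrow> q = m"
    by (auto simp: A_def below_def)
  have odd: "m (- z) = - m z" for z
  proof (rule antisym)
    obtain r where r: "sublinear r" "\<And>y. r y \<le> m y" "r (- z) \<le> - m z"
      using sublinear_descent[OF m(1)] by blast
    have "r = m"
      using min[OF r(1) _ r(2)] r(2) m(2) order_trans by blast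
    with r(3) show "m (- z) \<le> - m z"
      by simp
    show "- m z \<le> m (- z)"
      using sublinear_minus_lower[OF m(1), of "- z"] by simp
  qed
  show thesis
  proof
    show "linear m"
    proof (rule linearI)
      show "m (y + z) = m y + m z" for y z
        using sublinear_add[OF m(1), of y z] sublinear_add[OF m(1), of "- y" "- z"]
          odd[of "y + z"] odd[of y] odd[of z] by simp
      show "m (c *\<^sub>R y) = c *\<^sub>R m y" for c y
        using sublinear_scale[OF m(1), of c y] sublinear_scale[OF m(1), of "- c" y] odd[of "c *\<^sub>R y"]
        by (cases "0 \<le> c") auto
    qed
    show "m y \<le> p y" for y
      using m(2) q0(2) order_trans by blast
    have "m x \<le> p x"
      using m(2) q0(2) order_trans by blast
    moreover have "p x \<le> m x"
      using m(2)[of "- x"] q0(3) odd[of x] by simp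
    ultimately show "m x = p x"
      by simp
  qed
qed

lemma norming_functional:
  fixes x :: "'a::real_normed_vector"
  obtains \<phi> :: "'a \<Rightarrow>\<^sub>L real" where "norm \<phi> \<le> 1" "blinfun_apply \<phi> x = norm x"
proof -
  have "sublinear (norm :: 'a \<Rightarrow> real)"
    by (simp add: sublinear_def norm_triangle_ineq)
  then obtain f :: "'a \<Rightarrow> real" where f: "linear f" "\<And>y. f y \<le> norm y" "f x = norm x"
    using Hahn_Banach_sublinear by blast
  have abs: "norm (f y) \<le> norm y * 1" for y
    using f(2)[of y] f(2)[of "- y"] linear_neg[OF f(1), of y] by (simp add: abs_le_iff)
  have bl: "bounded_linear f"
    using f(1) abs by (intro bounded_linear_intro[of f 1]) (simp_all add: linear_add linear_scale)
  have "norm (Blinfun f) \<le> 1"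
    using abs by (intro norm_blinfun_bound) (simp_all add: bounded_linear_Blinfun_apply[OF bl])
  moreover have "blinfun_apply (Blinfun f) x = norm x"
    using f(3) by (simp add: bounded_linear_Blinfun_apply[OF bl])
  ultimately show thesis ..
qed

text \<open>
  The vectors \<open>x j\<close> act by evaluation on the space of bounded real functionals, which is complete. By
  Baire one bound \<open>n\<close> works on a whole ball around some \<open>\<phi>\<close>; moving from
  \<open>\<phi>\<close> in the direction of a functional that norms \<open>x j\<close> turns this into a bound for \<open>norm (x j)\<close>.
\<close>

lemma weakly_bounded_imp_norm_bounded:
  fixes x :: "'i \<Rightarrow> 'a::real_normed_vector"
  assumes weak: "\<And>\<phi> :: 'a \<Rightarrow>\<^sub>L real. \<exists>M. \<forall>j. \<bar>blinfun_apply \<phi> (x j)\<bar> \<le> M"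
  obtains M where "\<And>j. norm (x j) \<le> M"
proof -
  define A where "A n = {\<phi> :: 'a \<Rightarrow>\<^sub>L real. \<forall>j. \<bar>blinfun_apply \<phi> (x j)\<bar> \<le> real n}" for n :: nat
  have closed: "closed (A n)" for n
  proof -
    have "A n = (\<Inter>j. {\<phi>. \<bar>blinfun_apply \<phi> (x j)\<bar> \<le> real n})"
      by (auto simp: A_def)
    moreover have "closed {\<phi> :: 'a \<Rightarrow>\<^sub>L real. \<bar>blinfun_apply \<phi> (x j)\<bar> \<le> real n}" for j
      by (intro closed_Collect_le continuous_intros)
    ultimately show ?thesis
      by auto
  qed
  have "(\<Union>n. A n) = UNIV"
  proof -
    have "\<exists>n. \<phi> \<in> A n" for \<phi>
    proof -
      obtain M where "\<forall>j. \<bar>blinfun_apply \<phi> (x j)\<bar> \<le> M"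
        using weak by blast
      moreover obtain n where "M \<le> real n"
        using real_arch_simple by blast
      ultimately show ?thesis
        unfolding A_def using order_trans by blast
    qed
    then show ?thesis by blast
  qed
  then have "\<exists>n. interior (A n) \<noteq> {}"
    using Baire_category_alt[of "euclidean :: ('a \<Rightarrow>\<^sub>L real) topology" "range A"] closed
      completely_metrizable_space_euclidean
    by fastforce
  then obtain n \<phi> e where e: "0 < e" "cball \<phi> e \<subseteq> A n"
    by (meson ex_in_conv mem_interior_cball)
  have "norm (x j) \<le> 2 * real n / e" for j
  proof -
    obtain \<psi> :: "'a \<Rightarrow>\<^sub>L real" where \<psi>: "norm \<psi> \<le> 1" "blinfun_apply \<psi> (x j) = norm (x j)"
      by (rule norming_functional)
    have "\<phi> \<in> A n" "\<phi> + e *\<^sub>R \<psi> \<in> A n"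
      using e \<psi>(1) by (auto simp: dist_norm intro!: subsetD[OF e(2)])
    then have "\<bar>blinfun_apply \<phi> (x j)\<bar> \<le> n" "\<bar>blinfun_apply \<phi> (x j) + e * norm (x j)\<bar> \<le> n"
      by (simp_all add: A_def blinfun.add_left blinfun.scaleR_left flip: \<psi>(2))
    then have "e * norm (x j) \<le> 2 * real n"
      by linarith
    with e(1) show ?thesis
      by (simp add: field_simps)
  qed
  then show thesis ..
qed

section \<open>Functionals over the scalar field\<close>

lemma dual_add: "f \<in> dual sE \<Longrightarrow> f (x + y) = f x + f y"
  and dual_scale: "f \<in> dual sE \<Longrightarrow> f (sE c x) = c * f x"
  and dual_bounded_linear: "f \<in> dual sE \<Longrightarrow> bounded_linear f"
  by (auto simp: dual_def bounded_operator_def Vector_Spaces.linear_iff)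

lemma dual_zero: "f \<in> dual sE \<Longrightarrow> f 0 = 0"
  by (intro linear_0 bounded_linear.linear dual_bounded_linear)

lemma imaginary_unit_norm:
  fixes \<iota> :: "'k::real_normed_field"
  assumes "\<iota> * \<iota> = - 1"
  shows "norm \<iota> = 1"
proof -
  have "norm \<iota> * norm \<iota> = 1"
    using assms by (simp flip: norm_mult)
  then show ?thesis
    by (metis abs_norm_cancel abs_square_eq_1 power2_eq_square)
qed

text \<open>
  The norm is only known to be multiplicative, not to be the usual one of the complex numbers, so
  conjugation is not available as an isometry. Multiplying by the conjugate and estimating its norm
  by \<open>\<bar>a\<bar> + \<bar>b\<bar>\<close> costs only a constant factor.
\<close>

lemma abs_real_part_le:
  fixes \<iota> :: "'k::real_normed_field"
  assumes \<iota>: "\<iota> * \<iota> = - 1"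
  shows "\<bar>a\<bar> \<le> 2 * norm (of_real a - \<iota> * of_real b)"
proof (cases "a = 0")
  case False
  have "(of_real a - \<iota> * of_real b) * (of_real a + \<iota> * of_real b) = of_real (a\<^sup>2 + b\<^sup>2)"
  proof -
    have "(of_real a - \<iota> * of_real b) * (of_real a + \<iota> * of_real b)
        = of_real (a\<^sup>2) - (\<iota> * \<iota>) * of_real (b\<^sup>2)"
      by (simp add: algebra_simps power2_eq_square)
    then show ?thesis
      by (simp add: \<iota>)
  qed
  then have "norm (of_real a - \<iota> * of_real b) * norm (of_real a + \<iota> * of_real b) = a\<^sup>2 + b\<^sup>2"
    by (metis abs_of_nonneg norm_mult norm_of_real sum_power2_ge_zero)
  moreover have "norm (of_real a + \<iota> * of_real b) \<le> \<bar>a\<bar> + \<bar>b\<bar>"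
    using norm_triangle_ineq[of "of_real a" "\<iota> * of_real b"]
    by (simp add: norm_mult imaginary_unit_norm[OF \<iota>])
  ultimately have "a\<^sup>2 + b\<^sup>2 \<le> norm (of_real a - \<iota> * of_real b) * (\<bar>a\<bar> + \<bar>b\<bar>)"
    by (metis mult_left_mono norm_ge_zero)
  moreover have "s * (s + t) \<le> 2 * (s\<^sup>2 + t\<^sup>2)" for s t :: real
  proof -
    have "0 \<le> (s - t / 2)\<^sup>2 + 7 / 4 * t\<^sup>2"
      by simp
    then show ?thesis
      by (simp add: power2_eq_square algebra_simps)
  qed
  from this[of "\<bar>a\<bar>" "\<bar>b\<bar>"] have "\<bar>a\<bar> * (\<bar>a\<bar> + \<bar>b\<bar>) \<le> 2 * (a\<^sup>2 + b\<^sup>2)"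
    by simp
  ultimately have "\<bar>a\<bar> * (\<bar>a\<bar> + \<bar>b\<bar>) \<le> 2 * norm (of_real a - \<iota> * of_real b) * (\<bar>a\<bar> + \<bar>b\<bar>)"
    using mult_left_mono[of "a\<^sup>2 + b\<^sup>2" _ 2] by (simp only: mult.assoc) (meson order_trans zero_le_numeral)
  moreover have "0 < \<bar>a\<bar> + \<bar>b\<bar>"
    using False by linarith
  ultimately show ?thesis
    by (simp only: mult_le_cancel_right_pos)
qed simp

context banach_space
begin

lemma vector_space_mult: "vector_space ((*) :: 'k \<Rightarrow> 'k \<Rightarrow> 'k)"
  by standard (simp_all add: algebra_simps)

lemma dualI:
  assumes "bounded_linear f" "\<And>c x. f (scale c x) = c * f x"
  shows "f \<in> dual scale"
  using assms vector_space_mult vector_space_axioms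
  by (simp add: dual_def bounded_operator_def Vector_Spaces.linear_iff bounded_linear.linear linear_add)

lemma bounded_linear_scale: "bounded_linear (scale c)"
proof (rule bounded_linear_intro)
  show "scale c (x + y) = scale c x + scale c y" for x y
    by (rule scale_right_distrib)
  show "scale c (r *\<^sub>R x) = r *\<^sub>R scale c x" for r x
    by (metis scale_left_commute scale_of_real)
  show "norm (scale c x) \<le> norm x * norm c" for x
    by (simp add: norm_scale mult.commute)
qed

text \<open>
  For real scalars \<open>F\<close> is \<open>g\<close> itself. For complex ones \<open>F x = g x - \<iota> g (\<iota> x)\<close> is linear over the scalars
  and has real part \<open>g\<close>. Hence a
  sequence on which the dual is bounded is bounded under all real functionals, and a vector that real
  functionals separate from 0 is separated from 0 by the dual.
\<close>

lemma real_functional_dominated_by_dual: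
  assumes g: "bounded_linear g"
  obtains F where "F \<in> dual scale" "\<And>x. \<bar>g x :: real\<bar> \<le> 2 * norm (F x)"
proof -
  interpret g: bounded_linear g by fact
  have g_of_real: "g (scale (of_real a) x) = a * g x" for a x
    by (simp add: scale_of_real g.scaleR)
  show thesis
    using real_or_complex[where 'a='k]
  proof
    assume real: "\<forall>z::'k. \<exists>a. z = a *\<^sub>R 1"
    show thesis
    proof
      show "(\<lambda>x. of_real (g x)) \<in> dual scale"
      proof (rule dualI)
        show "bounded_linear (\<lambda>x. of_real (g x) :: 'k)"
          by (intro bounded_linear_compose[OF bounded_linear_of_real] g)
        fix c :: 'k and x
        obtain a where "c = of_real a"
          using real by (auto simp: of_real_def)
        then show "of_real (g (scale c x)) = c * (of_real (g x) :: 'k)"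
          by (simp add: g_of_real)
      qed
      show "\<bar>g x\<bar> \<le> 2 * norm (of_real (g x) :: 'k)" for x
        by simp
    qed
  next
    assume "\<exists>\<iota>::'k. \<iota> * \<iota> = - 1 \<and> (\<forall>z. \<exists>a b. z = a *\<^sub>R 1 + b *\<^sub>R \<iota>)"
    then obtain \<iota> :: 'k where \<iota>: "\<iota> * \<iota> = - 1" and cx: "\<And>z. \<exists>a b. z = a *\<^sub>R 1 + b *\<^sub>R \<iota>"
      by blast
    define F where "F x = of_real (g x) - \<iota> * of_real (g (scale \<iota> x))" for x
    show thesis
    proof
      show "F \<in> dual scale"
      proof (rule dualI)
        show bl: "bounded_linear F"
          unfolding F_def
          by (intro bounded_linear_sub bounded_linear_const_mult
              bounded_linear_compose[OF bounded_linear_of_real]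
              g bounded_linear_compose[OF g bounded_linear_scale])
        fix c :: 'k and x
        interpret F: bounded_linear F by fact
        have rot: "F (scale \<iota> x) = \<iota> * F x"
        proof -
          have "g (scale \<iota> (scale \<iota> x)) = - g x"
            by (simp add: \<iota> g.neg)
          then have "F (scale \<iota> x) = of_real (g (scale \<iota> x)) + \<iota> * of_real (g x)"
            unfolding F_def by (simp only: of_real_minus mult_minus_right diff_minus_eq_add)
          also have "\<dots> = \<iota> * F x"
            using \<iota> by (simp add: F_def right_diff_distrib flip: mult.assoc)
          finally show ?thesis .
        qed
        obtain a b where c: "c = of_real a + of_real b * \<iota>"
          using cx[of c] by (auto simp: scaleR_conv_of_real)
        have "scale c x = a *\<^sub>R x + b *\<^sub>R scale \<iota> x"
          by (simp add: c scale_left_distrib scale_of_real flip: scale_scale)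
        then show "F (scale c x) = c * F x"
          by (simp add: F.add F.scaleR rot c scaleR_conv_of_real distrib_right mult.assoc)
      qed
      show "\<bar>g x\<bar> \<le> 2 * norm (F x)" for x
        unfolding F_def by (rule abs_real_part_le[OF \<iota>])
    qed
  qed
qed

lemma dual_separates:
  assumes "x \<noteq> 0"
  obtains f where "f \<in> dual scale" "f x = 1"
proof -
  obtain \<phi> :: "'e \<Rightarrow>\<^sub>L real" where \<phi>: "blinfun_apply \<phi> x = norm x"
    using norming_functional by blast
  obtain F where F: "F \<in> dual scale" "\<And>x. \<bar>blinfun_apply \<phi> x\<bar> \<le> 2 * norm (F x)"
    using real_functional_dominated_by_dual[OF blinfun.bounded_linear_right] by blast
  have "F x \<noteq> 0"
    using F(2)[of x] \<phi> assms by auto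
  moreover have "(\<lambda>y. inverse (F x) * F y) \<in> dual scale"
    using F(1) by (intro dualI bounded_linear_const_mult dual_bounded_linear) (auto simp: dual_scale)
  ultimately show thesis
    using that[of "\<lambda>y. inverse (F x) * F y"] by simp
qed

section \<open>The space of weakly null sequences\<close>

lemma c0w_bounded:
  assumes x: "x \<in> c0w scale"
  obtains M where "\<And>j. norm (x j) \<le> M"
proof (rule weakly_bounded_imp_norm_bounded)
  fix \<phi> :: "'e \<Rightarrow>\<^sub>L real"
  obtain F where F: "F \<in> dual scale" "\<And>x. \<bar>blinfun_apply \<phi> x\<bar> \<le> 2 * norm (F x)"
    using real_functional_dominated_by_dual[OF blinfun.bounded_linear_right] by blast
  have "Bseq (\<lambda>j. F (x j))"
    using x F(1) by (auto simp: c0w_def intro!: convergent_imp_Bseq convergentI)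
  then obtain K where "\<And>j. norm (F (x j)) \<le> K"
    by (auto simp: Bseq_def)
  then have "\<bar>blinfun_apply \<phi> (x j)\<bar> \<le> 2 * K" for j
    using F(2)[of "x j"] by (smt (verit))
  then show "\<exists>M. \<forall>j. \<bar>blinfun_apply \<phi> (x j)\<bar> \<le> M"
    by blast
qed (rule that)

lemma norm_le_sup_norm:
  assumes "x \<in> c0w scale"
  shows "norm (x j) \<le> sup_norm x"
proof -
  obtain M where "\<And>j. norm (x j) \<le> M"
    using c0w_bounded[OF assms] by blast
  then show ?thesis
    unfolding sup_norm_def by (intro cSUP_upper bdd_aboveI2) auto
qed

lemma sup_norm_le: "(\<And>j. norm (x j) \<le> M) \<Longrightarrow> sup_norm x \<le> M"
  unfolding sup_norm_def by (rule cSUP_least) auto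

lemma subspace_c0w: "module.subspace (seq_scale scale) (c0w scale)"
proof -
  interpret seq: vector_space "seq_scale scale"
    by (rule vector_space_seq_scale) (rule vector_space_axioms)
  show ?thesis
  proof (rule seq.subspaceI)
    show "0 \<in> c0w scale"
      unfolding c0w_def
    proof (intro CollectI ballI)
      fix f assume "f \<in> dual scale"
      then show "(\<lambda>j. f (0 j)) \<longlonglongrightarrow> 0"
        by (simp add: dual_zero)
    qed
    show "x + y \<in> c0w scale" if "x \<in> c0w scale" "y \<in> c0w scale" for x y
      using that by (auto simp: c0w_def dual_add intro!: tendsto_add_zero)
    show "seq_scale scale c x \<in> c0w scale" if "x \<in> c0w scale" for c x
      using that by (auto simp: c0w_def seq_scale_def dual_scale intro!: tendsto_mult_right_zero)
  qed
qed

text \<open>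
  Completeness: a Cauchy sequence for the supremum norm converges uniformly in the index, and for
  each functional \<open>f\<close> a uniform limit of sequences that are null under \<open>f\<close> is null under \<open>f\<close>.
\<close>

lemma banach_sequence_space_c0w: "banach_sequence_space scale (c0w scale) sup_norm"
proof -
  interpret seq: vector_space "seq_scale scale"
    by (rule vector_space_seq_scale) (rule vector_space_axioms)
  let ?X = "c0w scale"
  have diff: "x - y \<in> ?X" if "x \<in> ?X" "y \<in> ?X" for x y
    using seq.subspace_diff[OF subspace_c0w that] .
  have sup_norm_nonneg: "0 \<le> sup_norm x" if "x \<in> ?X" for x
    using norm_le_sup_norm[OF that, of 0] norm_ge_zero order_trans by blast
  have sup_norm_zero: "sup_norm x = 0 \<longleftrightarrow> x = 0" if "x \<in> ?X" for x
  proof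
    assume "sup_norm x = 0"
    then show "x = 0"
      using norm_le_sup_norm[OF that] by (simp add: fun_eq_iff)
  qed (simp add: sup_norm_def)
  have sup_norm_triangle: "sup_norm (x + y) \<le> sup_norm x + sup_norm y" if "x \<in> ?X" "y \<in> ?X" for x y
    using norm_le_sup_norm[OF that(1)] norm_le_sup_norm[OF that(2)]
    by (auto intro!: sup_norm_le norm_triangle_mono)
  have sym: "sup_norm (x - y) = sup_norm (y - x)" for x y :: "nat \<Rightarrow> 'e"
    by (simp add: sup_norm_def norm_minus_commute)
  interpret Metric_space ?X "norm_dist ?X sup_norm"
  proof
    fix x y z
    show "0 \<le> norm_dist ?X sup_norm x y"
      by (simp add: norm_dist_def sup_norm_nonneg diff)
    show "norm_dist ?X sup_norm x y = norm_dist ?X sup_norm y x"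
      by (simp add: norm_dist_def sym)
    show "norm_dist ?X sup_norm x y = 0 \<longleftrightarrow> x = y" if "x \<in> ?X" "y \<in> ?X"
      using that by (simp add: norm_dist_def sup_norm_zero diff)
    show "norm_dist ?X sup_norm x z \<le> norm_dist ?X sup_norm x y + norm_dist ?X sup_norm y z"
      if "x \<in> ?X" "y \<in> ?X" "z \<in> ?X"
      using sup_norm_triangle[OF diff[OF that(1,2)] diff[OF that(2,3)]] that by (simp add: norm_dist_def)
  qed
  have complete: mcomplete
    unfolding mcomplete_def
  proof (intro allI impI)
    fix \<sigma>
    assume "MCauchy \<sigma>"
    then have \<sigma>: "\<And>n. \<sigma> n \<in> ?X"
      and cauchy: "\<And>e. 0 < e \<Longrightarrow> \<exists>N. \<forall>m n. N \<le> m \<longrightarrow> N \<le> n \<longrightarrow> sup_norm (\<sigma> m - \<sigma> n) < e"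
      by (auto simp: MCauchy_def norm_dist_def subset_iff)
    have pointwise: "norm (\<sigma> m j - \<sigma> n j) \<le> sup_norm (\<sigma> m - \<sigma> n)" for m n j
      using norm_le_sup_norm[OF diff[OF \<sigma> \<sigma>], of m n j] by simp
    have "Cauchy (\<lambda>n. \<sigma> n j)" for j
    proof (rule CauchyI)
      fix e :: real assume "0 < e"
      then obtain N where "\<forall>m n. N \<le> m \<longrightarrow> N \<le> n \<longrightarrow> sup_norm (\<sigma> m - \<sigma> n) < e"
        using cauchy by blast
      then show "\<exists>N. \<forall>m\<ge>N. \<forall>n\<ge>N. norm (\<sigma> m j - \<sigma> n j) < e"
        using pointwise le_less_trans by blast
    qed
    then obtain w where w: "\<And>j. (\<lambda>n. \<sigma> n j) \<longlonglongrightarrow> w j"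
      unfolding convergent_eq_Cauchy[symmetric] by metis
    have unif: "\<exists>N. \<forall>n\<ge>N. \<forall>j. norm (\<sigma> n j - w j) \<le> e" if "0 < e" for e
    proof -
      obtain N where N: "\<forall>m n. N \<le> m \<longrightarrow> N \<le> n \<longrightarrow> sup_norm (\<sigma> m - \<sigma> n) < e"
        using cauchy[OF \<open>0 < e\<close>] by blast
      have "norm (\<sigma> n j - w j) \<le> e" if "N \<le> n" for n j
      proof (rule tendsto_upperbound)
        show "(\<lambda>m. norm (\<sigma> n j - \<sigma> m j)) \<longlonglongrightarrow> norm (\<sigma> n j - w j)"
          by (intro tendsto_intros w)
        show "\<forall>\<^sub>F m in sequentially. norm (\<sigma> n j - \<sigma> m j) \<le> e"
          using N that pointwise[of n j]
          by (intro eventually_sequentiallyI[of N]) (meson less_imp_le order_trans)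
      qed simp
      then show ?thesis
        by blast
    qed
    have "w \<in> ?X"
      unfolding c0w_def
    proof (intro CollectI ballI)
      fix f assume f: "f \<in> dual scale"
      interpret f: bounded_linear f
        using dual_bounded_linear[OF f] .
      obtain K where K: "0 < K" "\<And>v. norm (f v) \<le> norm v * K"
        using f.pos_bounded by blast
      show "(\<lambda>j. f (w j)) \<longlonglongrightarrow> 0"
      proof (rule LIMSEQ_I)
        fix e :: real assume e: "0 < e"
        then obtain n where n: "\<And>j. norm (\<sigma> n j - w j) \<le> e / (2 * K)"
          using unif[of "e / (2 * K)"] K(1) by auto
        have "(\<lambda>j. f (\<sigma> n j)) \<longlonglongrightarrow> 0"
          using \<sigma>[of n] f by (simp add: c0w_def)
        then obtain J where J: "\<And>j. J \<le> j \<Longrightarrow> norm (f (\<sigma> n j)) < e / 2"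
          using LIMSEQ_D[of _ 0 "e / 2"] e by auto
        have "norm (f (w j) - 0) < e" if "J \<le> j" for j
        proof -
          have "norm (f (\<sigma> n j - w j)) \<le> e / (2 * K) * K"
            using K(2)[of "\<sigma> n j - w j"] n[of j] K(1)
            by (meson less_imp_le mult_right_mono order_trans)
          then have "norm (f (\<sigma> n j) - f (w j)) \<le> e / 2"
            using K(1) by (simp add: f.diff)
          then show ?thesis
            using J[OF that] norm_triangle_ineq2[of "f (w j)" "f (\<sigma> n j)"]
            by (simp add: norm_minus_commute)
        qed
        then show "\<exists>J. \<forall>j\<ge>J. norm (f (w j) - 0) < e"
          by blast
      qed
    qed
    moreover have "\<exists>N. \<forall>n\<ge>N. \<sigma> n \<in> ?X \<and> norm_dist ?X sup_norm (\<sigma> n) w < e" if "0 < e" for e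
    proof -
      obtain N where N: "\<And>n j. N \<le> n \<Longrightarrow> norm (\<sigma> n j - w j) \<le> e / 2"
        using unif[of "e / 2"] \<open>0 < e\<close> by auto
      have "sup_norm (\<sigma> n - w) \<le> e / 2" if "N \<le> n" for n
        using N[OF that] by (intro sup_norm_le) simp
      then show ?thesis
        using \<open>0 < e\<close> \<sigma> \<open>w \<in> ?X\<close> by (intro exI[of _ N]) (fastforce simp: norm_dist_def)
    qed
    ultimately show "\<exists>w. limitin mtopology \<sigma> w sequentially"
      unfolding limit_metric_sequentially by blast
  qed
  show ?thesis
  proof
    show "sup_norm (seq_scale scale c x) = norm c * sup_norm x" if x: "x \<in> ?X" for c x
    proof (rule antisym)
      show "sup_norm (seq_scale scale c x) \<le> norm c * sup_norm x"
        using norm_le_sup_norm[OF x]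
        by (intro sup_norm_le) (simp add: seq_scale_def norm_scale mult_left_mono)
      have cx: "seq_scale scale c x \<in> ?X"
        using seq.subspace_scale[OF subspace_c0w x] .
      show "norm c * sup_norm x \<le> sup_norm (seq_scale scale c x)"
      proof (cases "c = 0")
        case True
        then show ?thesis
          using sup_norm_nonneg[OF cx] by simp
      next
        case False
        then have "norm (x j) \<le> sup_norm (seq_scale scale c x) / norm c" for j
          using norm_le_sup_norm[OF cx, of j] by (simp add: seq_scale_def norm_scale field_simps)
        then have "sup_norm x \<le> sup_norm (seq_scale scale c x) / norm c"
          by (rule sup_norm_le)
        with False show ?thesis
          by (simp add: field_simps)
      qed
    qed
  qed (fact subspace_c0w sup_norm_nonneg sup_norm_zero sup_norm_triangle complete)+
qed

section \<open>Weakly summable sequences\<close>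

lemma weakly_p_summable_subseq:
  assumes "weakly_p_summable scale p x" "strict_mono r"
  shows "weakly_p_summable scale p (x \<circ> r)"
proof -
  have "summable (\<lambda>j. norm (f ((x \<circ> r) j)) powr p)" if "f \<in> dual scale" for f
    using summable_reindex[of "\<lambda>j. norm (f (x j)) powr p" r] that assms
    by (auto simp: weakly_p_summable_def ell_def o_def strict_mono_imp_inj_on)
  then show ?thesis
    by (simp add: weakly_p_summable_def ell_def)
qed

lemma weakly_p_summable_scale:
  assumes p: "0 \<le> p" and x: "weakly_p_summable scale p x" and b: "\<And>j. norm (b j) \<le> M"
  shows "weakly_p_summable scale p (\<lambda>j. scale (b j) (x j))"
proof -
  have "summable (\<lambda>j. norm (f (scale (b j) (x j))) powr p)" if f: "f \<in> dual scale" for f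
  proof (rule summable_comparison_test)
    show "summable (\<lambda>j. M powr p * norm (f (x j)) powr p)"
      using x f by (intro summable_mult) (simp add: weakly_p_summable_def ell_def)
    have "norm (f (scale (b j) (x j))) powr p \<le> M powr p * norm (f (x j)) powr p" for j
      using b[of j] p f by (simp add: dual_scale norm_mult powr_mult mult_right_mono powr_mono2)
    then show "\<exists>N. \<forall>j\<ge>N. norm (norm (f (scale (b j) (x j))) powr p)
        \<le> M powr p * norm (f (x j)) powr p"
      by simp
  qed
  then show ?thesis
    by (simp add: weakly_p_summable_def ell_def)
qed

lemma weakly_p_summable_imp_c0w:
  assumes p: "0 < p" and x: "weakly_p_summable scale p x"
  shows "x \<in> c0w scale"
  unfolding c0w_def
proof (intro CollectI ballI)
  fix f assume "f \<in> dual scale"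
  then have "(\<lambda>j. norm (f (x j)) powr p) \<longlonglongrightarrow> 0"
    using x by (intro summable_LIMSEQ_zero) (simp add: weakly_p_summable_def ell_def)
  then have "(\<lambda>j. (norm (f (x j)) powr p) powr (1 / p)) \<longlonglongrightarrow> 0 powr (1 / p)"
    using p by (intro tendsto_powr') auto
  then show "(\<lambda>j. f (x j)) \<longlonglongrightarrow> 0"
    using p by (simp add: powr_powr tendsto_norm_zero_iff)
qed

end

section \<open>Multiples of a sequence that are constant on infinite fibres\<close>

text \<open>
  Reading the index as a pair of numbers, the first component splits the indices into infinitely
  many infinite sets.
\<close>

abbreviation fibre :: "nat \<Rightarrow> nat"
  where "fibre j \<equiv> fst (prod_decode j)"

text \<open>
  For functionals \<open>f j\<close> in the dual with \<open>f j (y j) = 1\<close>, these are the weakly null sequences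
  \<open>b j \<cdot> y j\<close> with \<open>b\<close> constant on the fibres, since \<open>f j\<close> reads off the coefficient \<open>b j\<close>. In this form
  the condition consists of equations between continuous functions of \<open>w\<close>, so it is visibly closed.
\<close>

definition fibrewise_multiples ::
  "('k::real_or_complex \<Rightarrow> 'e::banach \<Rightarrow> 'e) \<Rightarrow> (nat \<Rightarrow> 'e \<Rightarrow> 'k) \<Rightarrow> (nat \<Rightarrow> 'e) \<Rightarrow> (nat \<Rightarrow> 'e) set"
  where "fibrewise_multiples sE f y =
    {w \<in> c0w sE. \<forall>i j. fibre i = fibre j \<longrightarrow> w i = sE (f j (w j)) (y i)}"

lemma fibrewise_multiplesD:
  "w \<in> fibrewise_multiples sE f y \<Longrightarrow> fibre i = fibre j \<Longrightarrow> w i = sE (f j (w j)) (y i)"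
  unfolding fibrewise_multiples_def by blast

lemma fibrewise_multiples_subset_c0w: "fibrewise_multiples sE f y \<subseteq> c0w sE"
  unfolding fibrewise_multiples_def by blast

context banach_space
begin

lemma subspace_fibrewise_multiples:
  assumes f: "\<And>j. f j \<in> dual scale"
  shows "module.subspace (seq_scale scale) (fibrewise_multiples scale f y)"
proof -
  interpret seq: vector_space "seq_scale scale"
    by (rule vector_space_seq_scale) (rule vector_space_axioms)
  note c0w = subspace_c0w
  let ?W = "fibrewise_multiples scale f y"
  note mult = fibrewise_multiplesD and sub = subsetD[OF fibrewise_multiples_subset_c0w]
  show ?thesis
  proof (rule seq.subspaceI)
    show "0 \<in> ?W"
      by (simp add: fibrewise_multiples_def seq.subspace_0[OF c0w] dual_zero[OF f])
  next
    fix v w assume vw: "v \<in> ?W" "w \<in> ?W"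
    have "(v + w) i = scale (f j ((v + w) j)) (y i)" if "fibre i = fibre j" for i j
      using mult[OF vw(1) that] mult[OF vw(2) that]
      by (simp only: plus_fun_apply dual_add[OF f] scale_left_distrib)
    moreover have "v + w \<in> c0w scale"
      using vw by (intro seq.subspace_add[OF c0w] sub)
    ultimately show "v + w \<in> ?W"
      unfolding fibrewise_multiples_def by blast
  next
    fix c w assume w: "w \<in> ?W"
    have "seq_scale scale c w i = scale (f j (seq_scale scale c w j)) (y i)"
      if "fibre i = fibre j" for i j
      using mult[OF w that] by (simp only: seq_scale_def dual_scale[OF f] flip: scale_scale)
    moreover have "seq_scale scale c w \<in> c0w scale"
      using w by (intro seq.subspace_scale[OF c0w] sub)
    ultimately show "seq_scale scale c w \<in> ?W"
      unfolding fibrewise_multiples_def by blast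
  qed
qed

lemma closedin_fibrewise_multiples:
  assumes f: "\<And>j. f j \<in> dual scale"
  shows "closedin (Metric_space.mtopology (c0w scale) (norm_dist (c0w scale) sup_norm))
    (fibrewise_multiples scale f y)"
proof -
  interpret seq: banach_sequence_space scale "c0w scale" sup_norm
    by (rule banach_sequence_space_c0w)
  interpret seqv: vector_space "seq_scale scale"
    by (rule vector_space_seq_scale) (rule vector_space_axioms)
  interpret Metric_space "c0w scale" "norm_dist (c0w scale) sup_norm"
    by (rule seq.Metric_space_norm_dist)
  show ?thesis
    unfolding metric_closedin_iff_sequentially_closed
  proof (intro conjI allI impI)
    show "fibrewise_multiples scale f y \<subseteq> c0w scale"
      by (rule fibrewise_multiples_subset_c0w)
    fix \<sigma> w
    assume *: "range \<sigma> \<subseteq> fibrewise_multiples scale f y \<and> limitin mtopology \<sigma> w sequentially"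
    then have w: "w \<in> c0w scale" and \<sigma>: "\<And>n. \<sigma> n \<in> c0w scale"
      and mult: "\<And>n i j. fibre i = fibre j \<Longrightarrow> \<sigma> n i = scale (f j (\<sigma> n j)) (y i)"
      and lim: "(\<lambda>n. norm_dist (c0w scale) sup_norm (\<sigma> n) w) \<longlonglongrightarrow> 0"
      by (auto simp: fibrewise_multiples_def limitin_metric_dist_null)
    have pw: "(\<lambda>n. \<sigma> n j) \<longlonglongrightarrow> w j" for j
    proof -
      have "norm (\<sigma> n j - w j) \<le> norm_dist (c0w scale) sup_norm (\<sigma> n) w" for n
        using norm_le_sup_norm[OF seqv.subspace_diff[OF subspace_c0w \<sigma> w], of n j] \<sigma> w
        by (simp add: norm_dist_def)
      then have "(\<lambda>n. \<sigma> n j - w j) \<longlonglongrightarrow> 0"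
        by (intro Lim_null_comparison[OF _ lim]) simp
      then show ?thesis
        by (simp add: LIM_zero_iff)
    qed
    have "w i = scale (f j (w j)) (y i)" if "fibre i = fibre j" for i j
    proof (rule LIMSEQ_unique[OF pw])
      have bl: "bounded_linear (\<lambda>c. scale c (y i))"
        by (rule bounded_linear_intro[of _ "norm (y i)"])
          (simp_all add: scale_left_distrib norm_scale scaleR_conv_of_real scale_of_real
            flip: scale_scale)
      have "(\<lambda>n. scale (f j (\<sigma> n j)) (y i)) \<longlonglongrightarrow> scale (f j (w j)) (y i)"
        by (intro bounded_linear.tendsto[OF bl]
            bounded_linear.tendsto[OF dual_bounded_linear[OF f]] pw)
      then show "(\<lambda>n. \<sigma> n i) \<longlonglongrightarrow> scale (f j (w j)) (y i)"
        using mult[OF that] by simp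
    qed
    with w show "w \<in> fibrewise_multiples scale f y"
      unfolding fibrewise_multiples_def by blast
  qed
qed

lemma fibrewise_multiplesI:
  assumes p: "0 < p" and y: "weakly_p_summable scale p y"
    and f: "\<And>j. f j \<in> dual scale" "\<And>j. f j (y j) = 1"
    and b: "\<And>k. norm (b k) \<le> M"
  shows "(\<lambda>j. scale (b (fibre j)) (y j)) \<in> fibrewise_multiples scale f y"
proof -
  have "weakly_p_summable scale p (\<lambda>j. scale (b (fibre j)) (y j))"
    using p y b by (intro weakly_p_summable_scale) auto
  then show ?thesis
    using weakly_p_summable_imp_c0w[OF p] by (simp add: fibrewise_multiples_def dual_scale[OF f(1)] f(2))
qed

text \<open>
  The restrictions \<open>e k\<close> of \<open>y\<close> to the fibres have disjoint supports and no zero on them, so evaluating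
  a linear relation at one index of the \<open>k\<close>-th fibre isolates the coefficient of \<open>e k\<close>.
\<close>

lemma fibrewise_multiples_infinite_dimensional:
  assumes p: "0 < p" and y: "weakly_p_summable scale p y"
    and f: "\<And>j. f j \<in> dual scale" "\<And>j. f j (y j) = 1"
  shows "\<nexists>S. finite S \<and> fibrewise_multiples scale f y = module.span (seq_scale scale) S"
proof
  interpret seq: vector_space "seq_scale scale"
    by (rule vector_space_seq_scale) (rule vector_space_axioms)
  assume "\<exists>S. finite S \<and> fibrewise_multiples scale f y = seq.span S"
  then obtain S where S: "finite S" "fibrewise_multiples scale f y = seq.span S"
    by blast
  have y0: "y j \<noteq> 0" for j
    using f(2)[of j] dual_zero[OF f(1)[of j]] by auto
  define e where "e k = (\<lambda>j. scale (if fibre j = k then 1 else 0) (y j))" for k :: nat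
  have e_eval: "e k (prod_encode (l, 0)) = (if l = k then y (prod_encode (l, 0)) else 0)" for k l
    by (simp add: e_def)
  have inj: "inj e"
  proof (rule injI)
    fix k l assume "e k = e l"
    then have "e k (prod_encode (k, 0)) = e l (prod_encode (k, 0))"
      by simp
    then show "k = l"
      using y0 by (auto simp: e_eval split: if_splits)
  qed
  have "seq.independent (range e)"
    unfolding seq.independent_explicit_module
  proof (intro allI impI)
    fix t u v
    assume t: "finite t" "t \<subseteq> range e" "(\<Sum>v\<in>t. seq_scale scale (u v) v) = 0" "v \<in> t"
    then obtain k where v: "v = e k" by blast
    let ?i = "prod_encode (k, 0)"
    have sum_apply: "(\<Sum>v\<in>t. seq_scale scale (u v) v) i = (\<Sum>v\<in>t. scale (u v) (v i))" for i
      using t(1) by (induction t rule: finite_induct) (auto simp: seq_scale_def)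
    have "0 = (\<Sum>v\<in>t. scale (u v) (v ?i))"
      using sum_apply[of ?i] t(3) by simp
    also have "\<dots> = scale (u v) (v ?i)"
    proof -
      have "(\<Sum>v'\<in>t - {v}. scale (u v') (v' ?i)) = 0"
      proof (rule sum.neutral, intro ballI)
        fix v' assume v': "v' \<in> t - {v}"
        then obtain l where "v' = e l" "l \<noteq> k"
          using t(2) v by blast
        then show "scale (u v') (v' ?i) = 0"
          by (simp add: e_eval)
      qed
      then show ?thesis
        using sum.remove[OF t(1,4), of "\<lambda>v. scale (u v) (v ?i)"] by simp
    qed
    finally show "u v = 0"
      using y0[of ?i] by (simp add: v e_eval)
  qed
  moreover have "range e \<subseteq> seq.span S"
  proof -
    have "e k \<in> fibrewise_multiples scale f y" for k
      unfolding e_def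
      by (rule fibrewise_multiplesI[where p=p and M=1 and b="\<lambda>j. if j = k then 1 else 0"])
        (auto simp: p y f)
    then show ?thesis
      unfolding S(2) by blast
  qed
  ultimately have "finite (range e)"
    using seq.independent_span_bound[OF S(1)] by blast
  then show False
    using inj by (simp add: finite_image_iff)
qed

text \<open>
  The coefficients \<open>f j (w j)\<close> are bounded by \<open>M / \<epsilon>\<close> when \<open>M\<close> bounds the norms of the \<open>w j\<close>.
\<close>

lemma fibrewise_multiples_weakly_p_summable:
  assumes p: "0 \<le> p" and y: "weakly_p_summable scale p y"
    and lower: "0 < \<epsilon>" "\<And>j. \<epsilon> \<le> norm (y j)"
    and w: "w \<in> fibrewise_multiples scale f y"
  shows "weakly_p_summable scale p w"
proof -
  have wj: "w j = scale (f j (w j)) (y j)" and wX: "w \<in> c0w scale" for j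
    using w unfolding fibrewise_multiples_def by blast+
  obtain M where M: "\<And>j. norm (w j) \<le> M"
    using c0w_bounded[OF wX] by blast
  have "norm (f j (w j)) \<le> M / \<epsilon>" for j
  proof -
    have "norm (f j (w j)) * \<epsilon> \<le> norm (f j (w j)) * norm (y j)"
      using lower(2) by (simp add: mult_left_mono)
    also have "\<dots> = norm (w j)"
      by (metis norm_scale wj)
    also have "\<dots> \<le> M" by (rule M)
    finally show ?thesis
      using lower(1) by (simp add: field_simps)
  qed
  then have "weakly_p_summable scale p (\<lambda>j. scale (f j (w j)) (y j))"
    by (rule weakly_p_summable_scale[OF p y])
  then show ?thesis
    by (simp flip: wj)
qed

text \<open>
  A nonzero term \<open>w j\<close> has a coefficient \<open>c \<noteq> 0\<close>, and \<open>w\<close> has this same coefficient on the whole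
  fibre of \<open>j\<close>. Along this infinite set the image stays above \<open>norm c * \<delta>\<close>.
\<close>

lemma fibrewise_multiples_image_not_null:
  fixes T :: "'e \<Rightarrow> 'f::banach"
  assumes sF: "banach_space sF" and T: "\<And>c x. T (scale c x) = sF c (T x)"
    and lower: "0 < \<delta>" "\<And>j. \<delta> \<le> norm (T (y j))"
    and w: "w \<in> fibrewise_multiples scale f y" "w \<noteq> 0"
  shows "\<not> (\<lambda>j. T (w j)) \<longlonglongrightarrow> 0"
proof
  interpret F: banach_space sF by fact
  obtain j where "w j \<noteq> 0"
    using w(2) by (auto simp: fun_eq_iff)
  define c where "c = f j (w j)"
  have mult: "w i = scale c (y i)" if "fibre i = fibre j" for i
    using w(1) that unfolding c_def by (rule fibrewise_multiplesD)
  have "c \<noteq> 0"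
    using mult[of j] \<open>w j \<noteq> 0\<close> by auto
  define r where "r m = prod_encode (fibre j, m)" for m
  have "filterlim r at_top sequentially"
    by (rule filterlim_at_top_mono[OF filterlim_ident])
      (simp add: r_def le_prod_encode_2)
  assume "(\<lambda>j. T (w j)) \<longlonglongrightarrow> 0"
  then have "(\<lambda>m. T (w (r m))) \<longlonglongrightarrow> 0"
    using \<open>filterlim r at_top sequentially\<close> by (rule filterlim_compose)
  then have "(\<lambda>m. norm (T (w (r m)))) \<longlonglongrightarrow> 0"
    by (rule tendsto_norm_zero)
  moreover have "norm c * \<delta> \<le> norm (T (w (r m)))" for m
    using lower(2)[of "r m"] by (simp add: mult r_def T F.norm_scale mult_left_mono)
  ultimately have "norm c * \<delta> \<le> 0"
    by (intro tendsto_lowerbound[OF _ always_eventually]) auto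
  then show False
    using lower(1) \<open>c \<noteq> 0\<close> by (simp add: mult_le_0_iff)
qed

end

lemma not_null_subseq:
  fixes a :: "nat \<Rightarrow> 'a::real_normed_vector"
  assumes "\<not> a \<longlonglongrightarrow> 0"
  obtains r :: "nat \<Rightarrow> nat" and \<delta> where "strict_mono r" "0 < \<delta>" "\<And>j. \<delta> \<le> norm (a (r j))"
proof -
  obtain \<delta> where \<delta>: "0 < \<delta>" "\<forall>N. \<exists>n\<ge>N. \<delta> \<le> norm (a n)"
    using assms unfolding LIMSEQ_iff by (metis diff_zero not_less)
  then have "infinite {n. \<delta> \<le> norm (a n)}"
    by (auto simp: infinite_nat_iff_unbounded_le)
  then obtain r :: "nat \<Rightarrow> nat" where "strict_mono r" "\<forall>j. r j \<in> {n. \<delta> \<le> norm (a n)}"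
    using infinite_enumerate by metis
  then show thesis
    using that[of r \<delta>] \<delta>(1) by simp
qed

theorem corollary3p7:
  fixes sE :: "'k::real_or_complex \<Rightarrow> 'e::banach \<Rightarrow> 'e"
    and sF :: "'k \<Rightarrow> 'f::banach \<Rightarrow> 'f"
    and T :: "'e \<Rightarrow> 'f" and p :: real
  assumes "1 \<le> p"
    and "banach_space sE" and "banach_space sF"
    and "bounded_operator sE sF T"
    and "\<not> p_convergent sE p T"
  shows "almost_pointwise_spaceable sE (c0w sE) sup_norm
    {x. weakly_p_summable sE p x \<and> \<not> (\<lambda>j. T (x j)) \<longlonglongrightarrow> 0}"
    (is "almost_pointwise_spaceable sE _ _ ?B")
proof -
  interpret E: banach_space sE by fact
  have p: "0 < p" using assms(1) by simp
  interpret T: bounded_linear T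
    using assms(4) by (simp add: bounded_operator_def)
  have T_scale: "T (sE c x) = sF c (T x)" for c x
    using assms(4) by (simp add: bounded_operator_def Vector_Spaces.linear_iff)
  obtain K where K: "0 < K" "\<And>x. norm (T x) \<le> norm x * K"
    using T.pos_bounded by blast
  have "\<exists>W. closed_infinite_dimensional_subspace sE (c0w sE) sup_norm W \<and> W \<subseteq> ?B \<union> {0} \<and>
      (\<exists>r. strict_mono r \<and> x \<circ> r \<in> W)" if "x \<in> ?B" for x
  proof -
    have x: "weakly_p_summable sE p x" "\<not> (\<lambda>j. T (x j)) \<longlonglongrightarrow> 0"
      using that by auto
    obtain r :: "nat \<Rightarrow> nat" and \<delta> where r: "strict_mono r" and \<delta>: "0 < \<delta>" "\<And>j. \<delta> \<le> norm (T (x (r j)))"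
      by (rule not_null_subseq[OF x(2)]) (rule that)
    define y where "y = x \<circ> r"
    have y: "weakly_p_summable sE p y"
      unfolding y_def using x(1) r by (rule E.weakly_p_summable_subseq)
    have Ty: "\<delta> \<le> norm (T (y j))" for j
      using \<delta>(2) by (simp add: y_def)
    have lower: "\<delta> / K \<le> norm (y j)" for j
      using order_trans[OF Ty K(2)] K(1) by (simp add: field_simps)
    have "0 < \<delta> / K"
      using \<delta>(1) K(1) by simp
    then have "y j \<noteq> 0" for j
      using lower[of j] by auto
    then have "\<exists>f. f \<in> dual sE \<and> f (y j) = 1" for j
      by (meson E.dual_separates)
    then obtain f where f: "\<And>j. f j \<in> dual sE" "\<And>j. f j (y j) = 1"
      by metis
    let ?W = "fibrewise_multiples sE f y"
    have "closed_infinite_dimensional_subspace sE (c0w sE) sup_norm ?W"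
      unfolding closed_infinite_dimensional_subspace_def
      by (intro conjI fibrewise_multiples_subset_c0w E.subspace_fibrewise_multiples[OF f(1)]
        E.closedin_fibrewise_multiples[OF f(1)] E.fibrewise_multiples_infinite_dimensional[OF p y f])
    moreover have "w \<in> ?B \<union> {0}" if "w \<in> ?W" for w
    proof (cases "w = 0")
      case False
      have "weakly_p_summable sE p w"
        using less_imp_le[OF p] y \<open>0 < \<delta> / K\<close> lower that
        by (rule E.fibrewise_multiples_weakly_p_summable)
      moreover have "\<not> (\<lambda>j. T (w j)) \<longlonglongrightarrow> 0"
        using assms(3) T_scale \<delta>(1) Ty that False by (rule E.fibrewise_multiples_image_not_null)
      ultimately show ?thesis
        by simp
    qed simp
    moreover have "x \<circ> r \<in> ?W"
      using E.fibrewise_multiplesI[OF p y f, of "\<lambda>_. 1" 1] by (simp flip: y_def)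
    ultimately show ?thesis
      using r by (intro exI[of _ ?W]) blast
  qed
  moreover have "?B \<noteq> {}"
    using assms(5) by (auto simp: p_convergent_def)
  moreover have "?B \<subseteq> c0w sE"
    using E.weakly_p_summable_imp_c0w[OF p] by blast
  ultimately show ?thesis
    unfolding almost_pointwise_spaceable_def using E.banach_sequence_space_c0w by blast
qed

end
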